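(* Let $G$ be a graph with graph Laplacian $\mathbf{L}$ and normalized graph Laplacian $\tilde{\mathbf{L}}$. If for a node-level positional encoding $\mathbf{Q}\in\mathbb{R}^{n\times d'}$ with compact domain there exist matrices $\mathbf{W}^Q,\mathbf{W}^K$ such that $$\frac{1}{\sqrt{d_k}}(\mathbf{Q}\mathbf{W}^Q)(\mathbf{Q}\mathbf{W}^K)^T=\tilde{\mathbf{L}},$$ then there exists a parameterization of the structural embeddings $\mathbf{P}$ with $\mathbf{Q}$ as node-level positional encoding such that $\mathbf{P}$ is sufficiently node- and adjacency-identifying.
   Context: Graphs are finite, undirected, without self-loops and without isolated nodes, with $n$ nodes, adjacency matrix $\mathbf{A}(G)$, degree matrix $\mathbf{D}$; $\mathbf{L}=\mathbf{D}-\mathbf{A}(G)$, $\tilde{\mathbf{L}}=\mathbf{I}-\mathbf{D}^{-1/2}\mathbf{A}(G)\mathbf{D}^{-1/2}$; $d_k>0$ is fixed. Structural embeddings with node-level positional encoding $\mathbf{Q}$: $\mathbf{P}(v)=\mathsf{FFN}(\mathrm{emb}_{\deg}(v)+\mathbf{Q}(v))$, where $\mathrm{emb}_{\deg}$ is a learnable embedding of the degree of $v$ and $\mathsf{FFN}$ an MLP (both parametrized; the embedding dimension is also a parameter). With $\tilde{\mathbf{P}}=\frac{1}{\sqrt{d_k}}\mathbf{P}\mathbf{W}^Q(\mathbf{P}\mathbf{W}^K)^T$: $\mathbf{P}$ is node-identifying if for some $\mathbf{W}^Q,\mathbf{W}^K$: $\tilde{\mathbf{P}}_{ij}=\max_k\tilde{\mathbf{P}}_{ik}\iff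 i=j$; adjacency-identifying if for some $\mathbf{W}^Q,\mathbf{W}^K$: $\tilde{\mathbf{P}}_{ij}=\max_k\tilde{\mathbf{P}}_{ik}\iff\mathbf{A}(G)_{ij}=1$. Parametrized structural embeddings are sufficiently node-identifying (resp. adjacency-identifying) if there is a node-identifying (resp. adjacency-identifying) matrix $\mathbf{P}^*$ such that for every $\varepsilon>0$ some parameter choice yields embeddings within Frobenius distance $\varepsilon$ of $\mathbf{P}^*$. *)

theory Defs
  imports Complex_Main
begin

text \<open>Matrices are rendered as functions nat => nat => real with explicit
  dimensions; an n x m matrix M only matters on entries i < n, j < m.
  Nodes of a graph with n nodes are 0..n-1.\<close>

definition is_graph :: "nat \<Rightarrow> (nat \<Rightarrow> nat \<Rightarrow> real) \<Rightarrow> bool" where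
  "is_graph n A \<longleftrightarrow>
     (\<forall>i<n. \<forall>j<n. A i j = 0 \<or> A i j = 1) \<and>
     (\<forall>i<n. \<forall>j<n. A i j = A j i) \<and>
     (\<forall>i<n. A i i = 0) \<and>
     (\<forall>i<n. \<exists>j<n. A i j = 1)"

definition degree :: "nat \<Rightarrow> (nat \<Rightarrow> nat \<Rightarrow> real) \<Rightarrow> nat \<Rightarrow> nat" where
  "degree n A v = card {u. u < n \<and> A v u = 1}"

definition laplacian :: "nat \<Rightarrow> (nat \<Rightarrow> nat \<Rightarrow> real) \<Rightarrow> nat \<Rightarrow> nat \<Rightarrow> real" where
  "laplacian n A i j = (if i = j then real (degree n A i) else 0) - A i j"

definition norm_laplacian :: "nat \<Rightarrow> (nat \<Rightarrow> nat \<Rightarrow> real) \<Rightarrow> nat \<Rightarrow> nat \<Rightarrow> real" where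
  "norm_laplacian n A i j =
     (if i = j then 1 else 0) - A i j / (sqrt (real (degree n A i)) * sqrt (real (degree n A j)))"

definition att_scores ::
  "nat \<Rightarrow> nat \<Rightarrow> (nat \<Rightarrow> nat \<Rightarrow> real) \<Rightarrow> (nat \<Rightarrow> nat \<Rightarrow> real) \<Rightarrow> (nat \<Rightarrow> nat \<Rightarrow> real)
     \<Rightarrow> nat \<Rightarrow> nat \<Rightarrow> real" where
  "att_scores d dk P WQ WK i j =
     (1 / sqrt (real dk)) * (\<Sum>t<dk. (\<Sum>a<d. P i a * WQ a t) * (\<Sum>b<d. P j b * WK b t))"

definition node_identifying :: "nat \<Rightarrow> nat \<Rightarrow> nat \<Rightarrow> (nat \<Rightarrow> nat \<Rightarrow> real) \<Rightarrow> bool" where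
  "node_identifying n d dk P \<longleftrightarrow>
     (\<exists>WQ WK. \<forall>i<n. \<forall>j<n.
        att_scores d dk P WQ WK i j = Max {att_scores d dk P WQ WK i k | k. k < n} \<longleftrightarrow> i = j)"

definition adjacency_identifying ::
  "nat \<Rightarrow> nat \<Rightarrow> nat \<Rightarrow> (nat \<Rightarrow> nat \<Rightarrow> real) \<Rightarrow> (nat \<Rightarrow> nat \<Rightarrow> real) \<Rightarrow> bool" where
  "adjacency_identifying n d dk A P \<longleftrightarrow>
     (\<exists>WQ WK. \<forall>i<n. \<forall>j<n.
        att_scores d dk P WQ WK i j = Max {att_scores d dk P WQ WK i k | k. k < n} \<longleftrightarrow> A i j = 1)"

definition frob_dist :: "nat \<Rightarrow> nat \<Rightarrow> (nat \<Rightarrow> nat \<Rightarrow> real) \<Rightarrow> (nat \<Rightarrow> nat \<Rightarrow> real) \<Rightarrow> real" where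
  "frob_dist n d P P' = sqrt (\<Sum>i<n. \<Sum>j<d. (P i j - P' i j)\<^sup>2)"

text \<open>MLP (feed-forward network) with ReLU activations between layers.
  ds = [d0, d1, ..., dL] are the layer widths, layers = [(W1,b1),...,(WL,bL)],
  W_l of size d_l x d_(l-1), b_l of size d_l.\<close>
definition affine :: "nat \<Rightarrow> nat \<Rightarrow> (nat \<Rightarrow> nat \<Rightarrow> real) \<Rightarrow> (nat \<Rightarrow> real) \<Rightarrow> (nat \<Rightarrow> real) \<Rightarrow> nat \<Rightarrow> real" where
  "affine m k W b x = (\<lambda>i. if i < k then (\<Sum>j<m. W i j * x j) + b i else 0)"

fun mlp :: "nat list \<Rightarrow> ((nat \<Rightarrow> nat \<Rightarrow> real) \<times> (nat \<Rightarrow> real)) list \<Rightarrow> (nat \<Rightarrow> real) \<Rightarrow> nat \<Rightarrow> real" where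
  "mlp (m # k # ds) ((W, b) # L) x =
     (let y = affine m k W b x in if L = [] then y else mlp (k # ds) L (\<lambda>i. max 0 (y i)))"
| "mlp _ _ x = x"

definition valid_mlp :: "nat \<Rightarrow> nat \<Rightarrow> nat list \<Rightarrow> ((nat \<Rightarrow> nat \<Rightarrow> real) \<times> (nat \<Rightarrow> real)) list \<Rightarrow> bool" where
  "valid_mlp din dout ds L \<longleftrightarrow> L \<noteq> [] \<and> length ds = length L + 1 \<and> hd ds = din \<and> last ds = dout"

definition struct_emb ::
  "nat \<Rightarrow> nat \<Rightarrow> (nat \<Rightarrow> nat \<Rightarrow> real) \<Rightarrow> (nat \<Rightarrow> nat \<Rightarrow> real) \<Rightarrow> (nat \<Rightarrow> nat \<Rightarrow> real)
     \<Rightarrow> nat list \<Rightarrow> ((nat \<Rightarrow> nat \<Rightarrow> real) \<times> (nat \<Rightarrow> real)) list \<Rightarrow> nat \<Rightarrow> nat \<Rightarrow> real" where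
  "struct_emb n d' A Q emb ds L = (\<lambda>v. mlp ds L (\<lambda>j. emb (degree n A v) j + Q v j))"

definition suff_node_identifying ::
  "nat \<Rightarrow> nat \<Rightarrow> nat \<Rightarrow> (nat \<Rightarrow> nat \<Rightarrow> real) \<Rightarrow> (nat \<Rightarrow> nat \<Rightarrow> real) \<Rightarrow> bool" where
  "suff_node_identifying n d' dk A Q \<longleftrightarrow>
     (\<exists>d Pstar. node_identifying n d dk Pstar \<and>
        (\<forall>\<epsilon>>0. \<exists>emb ds L. valid_mlp d' d ds L \<and>
            frob_dist n d (struct_emb n d' A Q emb ds L) Pstar < \<epsilon>))"

definition suff_adjacency_identifying ::
  "nat \<Rightarrow> nat \<Rightarrow> nat \<Rightarrow> (nat \<Rightarrow> nat \<Rightarrow> real) \<Rightarrow> (nat \<Rightarrow> nat \<Rightarrow> real) \<Rightarrow> bool" where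
  "suff_adjacency_identifying n d' dk A Q \<longleftrightarrow>
     (\<exists>d Pstar. adjacency_identifying n d dk A Pstar \<and>
        (\<forall>\<epsilon>>0. \<exists>emb ds L. valid_mlp d' d ds L \<and>
            frob_dist n d (struct_emb n d' A Q emb ds L) Pstar < \<epsilon>))"

end

theory Submission
  imports Defs
begin

text \<open>Row \<open>v\<close> of \<open>L~\<close> is \<open>1\<close> on the diagonal and \<open>\<le> 0\<close>
  elsewhere, so a linear layer computing that row, followed by ReLU, outputs the one-hot
  vector of \<open>v\<close>, which a second linear layer maps to \<open>sqrt (deg v) * Q v\<close>. Hence
  \<open>P = D^(1/2) Q\<close> is realised exactly by the structural embedding, and with the same
  weights its scores are \<open>D^(1/2) L~ D^(1/2) = L\<close>, whose rows peak strictly on the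
  diagonal; negating \<open>W^Q\<close> gives \<open>-L = A - D\<close>, whose rows peak exactly at the
  neighbours.\<close>

lemma degree_pos:
  assumes "is_graph n A" "i < n"
  shows "degree n A i > 0"
proof -
  obtain j where "j < n" "A i j = 1" using assms unfolding is_graph_def by blast
  then have "{u. u < n \<and> A i u = 1} \<noteq> {}" by blast
  then show ?thesis unfolding degree_def by (simp add: card_gt_0_iff)
qed

lemma laplacian_eq_scaled_norm_laplacian:
  assumes "is_graph n A" "i < n" "j < n"
  shows "laplacian n A i j
    = sqrt (real (degree n A i)) * sqrt (real (degree n A j)) * norm_laplacian n A i j"
proof (cases "i = j")
  case True
  then show ?thesis
    using assms unfolding is_graph_def laplacian_def norm_laplacian_def by simp
next
  case False
  have "degree n A i > 0" "degree n A j > 0" using degree_pos assms by blast+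
  then show ?thesis
    using False unfolding laplacian_def norm_laplacian_def by simp
qed

lemma relu_norm_laplacian:
  assumes "is_graph n A" "v < n" "j < n"
  shows "max 0 (norm_laplacian n A v j) = (if v = j then 1 else 0)"
proof -
  have "A v j \<ge> 0" "A v v = 0" using assms unfolding is_graph_def by force+
  then show ?thesis unfolding norm_laplacian_def by auto
qed

lemma att_scores_cong:
  assumes "\<And>a. a < d \<Longrightarrow> P i a = P' i a" "\<And>a. a < d \<Longrightarrow> P j a = P' j a"
  shows "att_scores d dk P WQ WK i j = att_scores d dk P' WQ WK i j"
  unfolding att_scores_def using assms by simp

lemma att_scores_scale_rows:
  "att_scores d dk (\<lambda>v a. s v * P v a) WQ WK i j = s i * s j * att_scores d dk P WQ WK i j"
proof -
  have "(\<Sum>a<d. s v * P v a * W a t) = s v * (\<Sum>a<d. P v a * W a t)" for v W t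
    by (simp add: sum_distrib_left mult.assoc)
  then show ?thesis unfolding att_scores_def by (simp add: sum_distrib_left mult_ac)
qed

lemma att_scores_uminus_query:
  "att_scores d dk P (\<lambda>a t. - WQ a t) WK i j = - att_scores d dk P WQ WK i j"
  unfolding att_scores_def by (simp add: sum_negf)

lemma att_scores_linear_in_query:
  "att_scores d dk P WQ WK v j
    = (\<Sum>a<d. (1 / sqrt (real dk)) * (\<Sum>t<dk. WQ a t * (\<Sum>b<d. P j b * WK b t)) * P v a)"
  unfolding att_scores_def
  by (simp add: sum_distrib_left sum_distrib_right mult_ac sum.swap[of _ "{..<dk}"])

lemma att_scores_degree_scaling:
  assumes "is_graph n A"
    and "\<And>i j. i < n \<Longrightarrow> j < n \<Longrightarrow> att_scores d dk Q WQ WK i j = norm_laplacian n A i j"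
    and "\<And>v a. v < n \<Longrightarrow> a < d \<Longrightarrow> P v a = sqrt (real (degree n A v)) * Q v a"
    and "i < n" "j < n"
  shows "att_scores d dk P WQ WK i j = laplacian n A i j"
proof -
  have "att_scores d dk P WQ WK i j
      = att_scores d dk (\<lambda>v a. sqrt (real (degree n A v)) * Q v a) WQ WK i j"
    by (rule att_scores_cong) (simp_all add: assms(3-5))
  also have "\<dots> = sqrt (real (degree n A i)) * sqrt (real (degree n A j))
      * att_scores d dk Q WQ WK i j"
    by (rule att_scores_scale_rows)
  also have "\<dots> = laplacian n A i j"
    using assms(2,4,5) laplacian_eq_scaled_norm_laplacian[OF assms(1,4,5)] by simp
  finally show ?thesis .
qed

lemma node_identifying_if_laplacian_scores:
  assumes "is_graph n A"
    and "\<And>i j. i < n \<Longrightarrow> j < n \<Longrightarrow> att_scores d dk P WQ WK i j = laplacian n A i j"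
  shows "node_identifying n d dk P"
  unfolding node_identifying_def
proof (intro exI allI impI)
  fix i j assume "i < n" "j < n"
  let ?S = "att_scores d dk P WQ WK"
  have lt: "?S i k < ?S i i" if "k < n" "k \<noteq> i" for k
  proof -
    have "A i k = 0 \<or> A i k = 1" "A i i = 0"
      using assms(1) \<open>i < n\<close> that(1) unfolding is_graph_def by auto
    then show ?thesis
      using assms(2) \<open>i < n\<close> that degree_pos[OF assms(1) \<open>i < n\<close>]
      unfolding laplacian_def by auto
  qed
  have "Max {?S i k | k. k < n} = ?S i i"
    by (rule Max_eqI) (use \<open>i < n\<close> lt in \<open>auto intro: less_imp_le\<close>)
  then show "?S i j = Max {?S i k | k. k < n} \<longleftrightarrow> i = j"
    using lt[OF \<open>j < n\<close>] by force
qed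

lemma adjacency_identifying_if_neg_laplacian_scores:
  assumes "is_graph n A"
    and "\<And>i j. i < n \<Longrightarrow> j < n \<Longrightarrow> att_scores d dk P WQ WK i j = - laplacian n A i j"
  shows "adjacency_identifying n d dk A P"
  unfolding adjacency_identifying_def
proof (intro exI allI impI)
  fix i j assume "i < n" "j < n"
  let ?S = "att_scores d dk P WQ WK"
  have score: "?S i k = (if A i k = 1 then 1 else if k = i then - real (degree n A i) else 0)"
    if "k < n" for k
  proof -
    have "A i k = 0 \<or> A i k = 1" "A i i = 0"
      using assms(1) \<open>i < n\<close> that unfolding is_graph_def by auto
    then show ?thesis using assms(2) \<open>i < n\<close> that unfolding laplacian_def by auto
  qed
  have deg: "degree n A i > 0" using degree_pos assms(1) \<open>i < n\<close> .
  obtain j0 where "j0 < n" "A i j0 = 1" using assms(1) \<open>i < n\<close> unfolding is_graph_def by blast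
  then have "1 \<in> {?S i k | k. k < n}" using score by force
  then have "Max {?S i k | k. k < n} = 1"
    by (intro Max_eqI) (use score deg in auto)
  then show "?S i j = Max {?S i k | k. k < n} \<longleftrightarrow> A i j = 1"
    using score[OF \<open>j < n\<close>] deg by auto
qed

lemma mlp_two_layer:
  "mlp [m, k, p] [(W1, \<lambda>_. 0), (W2, \<lambda>_. 0)] x a =
     (if a < p then \<Sum>j<k. W2 a j * max 0 (\<Sum>b<m. W1 j b * x b) else 0)"
  by (simp add: affine_def)

lemma struct_emb_realises_degree_scaling:
  assumes "is_graph n A"
    and "\<And>i j. i < n \<Longrightarrow> j < n \<Longrightarrow> att_scores d' dk Q WQ WK i j = norm_laplacian n A i j"
  obtains ds L emb where "valid_mlp d' d' ds L"
    and "\<And>v a. v < n \<Longrightarrow> a < d' \<Longrightarrow>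
           struct_emb n d' A Q emb ds L v a = sqrt (real (degree n A v)) * Q v a"
proof
  define W1 where
    "W1 j a = (1 / sqrt (real dk)) * (\<Sum>t<dk. WQ a t * (\<Sum>b<d'. Q j b * WK b t))" for j a
  define W2 where "W2 a j = sqrt (real (degree n A j)) * Q j a" for a j
  define ds where "ds = [d', n, d']"
  define L where "L = [(W1, \<lambda>_::nat. 0::real), (W2, \<lambda>_::nat. 0::real)]"
  show "valid_mlp d' d' ds L" unfolding valid_mlp_def ds_def L_def by simp
  fix v a assume "v < n" "a < d'"
  have first_layer: "(\<Sum>b<d'. W1 j b * Q v b) = norm_laplacian n A v j" if "j < n" for j
    using assms(2)[OF \<open>v < n\<close> that] unfolding W1_def att_scores_linear_in_query .
  have "struct_emb n d' A Q (\<lambda>_ _. 0) ds L v a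
      = (\<Sum>j<n. W2 a j * max 0 (\<Sum>b<d'. W1 j b * Q v b))"
    unfolding struct_emb_def ds_def L_def mlp_two_layer using \<open>a < d'\<close> by simp
  also have "\<dots> = (\<Sum>j<n. W2 a j * (if v = j then 1 else 0))"
    using first_layer relu_norm_laplacian[OF assms(1) \<open>v < n\<close>] by simp
  also have "\<dots> = W2 a v" using \<open>v < n\<close> by (simp add: if_distrib cong: if_cong)
  finally show "struct_emb n d' A Q (\<lambda>_ _. 0) ds L v a = sqrt (real (degree n A v)) * Q v a"
    unfolding W2_def .
qed

lemma suff_node_identifying_if_realised:
  assumes "valid_mlp d' d ds L" "node_identifying n d dk (struct_emb n d' A Q emb ds L)"
  shows "suff_node_identifying n d' dk A Q"
proof -
  have "frob_dist n d (struct_emb n d' A Q emb ds L) (struct_emb n d' A Q emb ds L) < \<epsilon>"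
    if "\<epsilon> > 0" for \<epsilon>
    using that by (simp add: frob_dist_def)
  then show ?thesis unfolding suff_node_identifying_def using assms by blast
qed

lemma suff_adjacency_identifying_if_realised:
  assumes "valid_mlp d' d ds L" "adjacency_identifying n d dk A (struct_emb n d' A Q emb ds L)"
  shows "suff_adjacency_identifying n d' dk A Q"
proof -
  have "frob_dist n d (struct_emb n d' A Q emb ds L) (struct_emb n d' A Q emb ds L) < \<epsilon>"
    if "\<epsilon> > 0" for \<epsilon>
    using that by (simp add: frob_dist_def)
  then show ?thesis unfolding suff_adjacency_identifying_def using assms by blast
qed

theorem lemmaF13:
  fixes n d' dk :: nat and A Q :: "nat \<Rightarrow> nat \<Rightarrow> real"
  assumes "is_graph n A"
    and "dk > 0"
    and "\<exists>WQ WK. \<forall>i<n. \<forall>j<n. att_scores d' dk Q WQ WK i j = norm_laplacian n A i j"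
  shows "suff_node_identifying n d' dk A Q \<and> suff_adjacency_identifying n d' dk A Q"
proof -
  obtain WQ WK where scores_Q:
    "\<And>i j. i < n \<Longrightarrow> j < n \<Longrightarrow> att_scores d' dk Q WQ WK i j = norm_laplacian n A i j"
    using assms(3) by blast
  obtain ds L emb where valid: "valid_mlp d' d' ds L"
    and P: "\<And>v a. v < n \<Longrightarrow> a < d' \<Longrightarrow>
              struct_emb n d' A Q emb ds L v a = sqrt (real (degree n A v)) * Q v a"
    using struct_emb_realises_degree_scaling[OF assms(1) scores_Q] by metis
  let ?P = "struct_emb n d' A Q emb ds L"
  have scores_P: "att_scores d' dk ?P WQ WK i j = laplacian n A i j" if "i < n" "j < n" for i j
    using att_scores_degree_scaling[OF assms(1) scores_Q P that] .
  have "node_identifying n d' dk ?P"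
    using node_identifying_if_laplacian_scores[OF assms(1)] scores_P .
  moreover have "adjacency_identifying n d' dk A ?P"
    by (rule adjacency_identifying_if_neg_laplacian_scores[OF assms(1), of _ _ _ "\<lambda>a t. - WQ a t" WK])
      (simp add: att_scores_uminus_query scores_P)
  ultimately show ?thesis
    using suff_node_identifying_if_realised[OF valid] suff_adjacency_identifying_if_realised[OF valid]
    by blast
qed

end
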